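(* Let $\mathbf{d}$ be the period-doubling word. Then $P(\mathbf{d}) = \frac{1}{2\ln 2} \approx 0.7213$ and $p(\mathbf{d}) = \frac{1}{4\ln2} \approx 0.36067$.
   Context: The period-doubling word $\mathbf{d}=1011101010111011\cdots$ is the fixed point of the morphism $1\mapsto 10$, $0\mapsto 11$. For a finite nonempty word $w$, an integer $p$ with $1\le p\le|w|$ is a period if $w[i]=w[i+p]$ for $1\le i\le |w|-p$; it is nontrivial if $p<|w|$; $\operatorname{nnp}(w)$ is the number of nontrivial periods; $\operatorname{per}(w)$ the least period; $\exp(w)=|w|/\operatorname{per}(w)$; $\operatorname{ice}(w)=\sup\{\exp(u): u \text{ a nonempty prefix of } w\}$. For a finite word $x$ with $|x|\ge2$ let $M(x)=\operatorname{nnp}(x)/(\operatorname{ice}(x)\ln|x|)$. For an infinite word $\mathbf{x}$ with length-$n$ prefix $Y_n$, define $P(\mathbf{x})=\limsup_{n\to\infty} M(Y_n)$ and $p(\mathbf{x})=\liminf_{n\to\infty} M(Y_n)$. *)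

theory Defs
  imports
    "HOL-Analysis.Analysis"
    "HOL-Library.Stream"
    "HOL-Library.Sublist"
    "HOL-Library.Z2"
begin

definition is_period :: "'a list \<Rightarrow> nat \<Rightarrow> bool" where
  "is_period w p \<longleftrightarrow>
     1 \<le> p \<and> p \<le> length w \<and> (\<forall>i < length w - p. w ! i = w ! (i + p))"

definition nnp :: "'a list \<Rightarrow> nat" where
  "nnp w = card {p. is_period w p \<and> p < length w}"

definition per :: "'a list \<Rightarrow> nat" where
  "per w = (LEAST p. is_period w p)"

definition word_exp :: "'a list \<Rightarrow> real" where
  "word_exp w = real (length w) / real (per w)"

definition ice :: "'a list \<Rightarrow> real" where
  "ice w = Sup {word_exp u | u. u \<noteq> [] \<and> prefix u w}"

text \<open>Only meaningful for words of length at least 2; the values at shorter words do not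
  affect the limits below.\<close>

definition M :: "'a list \<Rightarrow> real" where
  "M x = real (nnp x) / (ice x * ln (real (length x)))"

definition P_upper :: "'a stream \<Rightarrow> ereal" where
  "P_upper x = limsup (\<lambda>n. ereal (M (stake n x)))"

definition p_lower :: "'a stream \<Rightarrow> ereal" where
  "p_lower x = liminf (\<lambda>n. ereal (M (stake n x)))"

fun pd_morphism :: "bit \<Rightarrow> bit list" where
  "pd_morphism 1 = [1, 0]"
| "pd_morphism 0 = [1, 1]"

definition period_doubling :: "bit stream" where
  "period_doubling = (THE x. flat (smap pd_morphism x) = x)"

lemma pd_morphism_image_snth:
  "flat (smap pd_morphism x) !! n =
     (if even n then 1 else if x !! (n div 2) = 1 then 0 else 1)"
proof (induction n arbitrary: x rule: less_induct)
  case (less n)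
  obtain a y where x: "x = a ## y" by (cases x)
  have fl: "flat (smap pd_morphism x) = pd_morphism a @- flat (smap pd_morphism y)"
    unfolding x by (cases a) simp_all
  show ?case
  proof (cases "n < 2")
    case True
    then consider "n = 0" | "n = 1" by linarith
    then show ?thesis
      unfolding fl by cases (cases a; simp add: x)+
  next
    case False
    then obtain m where n: "n = Suc (Suc m)"
      by (metis One_nat_def Suc_1 add_2_eq_Suc le_Suc_ex not_less)
    have "flat (smap pd_morphism x) !! n = flat (smap pd_morphism y) !! m"
      unfolding fl n by (cases a) simp_all
    then show ?thesis
      using less.IH[of m y] by (simp add: n x)
  qed
qed

function pd_letter :: "nat \<Rightarrow> bit" where
  "pd_letter n = (if even n then 1 else if pd_letter (n div 2) = 1 then 0 else 1)"
  by auto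
termination
  by (relation "less_than") (auto elim: oddE)

declare pd_letter.simps [simp del]

lemma pd_fixed_point_iff:
  "flat (smap pd_morphism x) = x \<longleftrightarrow> x = smap pd_letter nats"
proof
  assume fp: "flat (smap pd_morphism x) = x"
  have "x !! n = pd_letter n" for n
  proof (induction n rule: less_induct)
    case (less n)
    have "x !! n = (if even n then 1 else if x !! (n div 2) = 1 then 0 else 1)"
      using pd_morphism_image_snth[of x n] by (simp only: fp)
    moreover have "odd n \<Longrightarrow> x !! (n div 2) = pd_letter (n div 2)"
      by (rule less.IH) (auto elim: oddE)
    ultimately show ?case
      by (simp add: pd_letter.simps[of n])
  qed
  then have "smap pd_letter nats = x"
    by (simp add: smap_alt)
  then show "x = smap pd_letter nats" ..
next
  assume x: "x = smap pd_letter nats"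
  have nats: "nats !! n = n" for n
    by simp
  have "smap pd_letter nats = flat (smap pd_morphism x)"
    unfolding smap_alt pd_morphism_image_snth x snth_smap nats
    by (intro allI pd_letter.simps)
  then show "flat (smap pd_morphism x) = x"
    by (simp add: x)
qed

lemma ex1_pd_fixed_point: "\<exists>!x. flat (smap pd_morphism x) = x"
  by (simp add: pd_fixed_point_iff)

lemma period_doubling_fixed_point: "flat (smap pd_morphism period_doubling) = period_doubling"
  unfolding period_doubling_def by (rule theI'[OF ex1_pd_fixed_point])

end

theory Submission
  imports Defs "HOL-Real_Asymp.Real_Asymp"
begin

text \<open>
  Counting positions from 1, the letter of the period-doubling word at position \<open>i\<close> is 1 iff the
  2-adic valuation of \<open>i\<close> is even. Hence, for odd \<open>q\<close>, the first positions at which the period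
  \<open>2\<^sup>k q\<close> can fail are \<open>2\<^sup>k\<close> and \<open>2\<^sup>k\<^sup>+\<^sup>1\<close>: it always fails at the second one, and at the first
  one iff the valuation of \<open>q + 1\<close> is odd. So a prefix of length \<open>n\<close> has at most one nontrivial
  period of each valuation, which gives at most about \<open>log\<^sub>2 n\<close> of them, attained at
  \<open>n = 2\<^sup>m - 1\<close>. Conversely, of any two consecutive valuations at least one occurs, which gives
  at least about \<open>log\<^sub>2 n / 2\<close> of them, attained at \<open>n = 2\<^sup>m\<close>. The same description shows that the
  initial critical exponent tends to 2.
\<close>

section \<open>2-adic valuations and the letters of the word\<close>

abbreviation val2 :: "nat \<Rightarrow> nat" where
  "val2 \<equiv> multiplicity 2"

lemma val2_odd: "odd q \<Longrightarrow> val2 q = 0"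
  by (rule not_dvd_imp_multiplicity_0)

lemma val2_power_mult: "0 < x \<Longrightarrow> val2 (2 ^ k * x) = k + val2 x"
  by (induction k) (auto simp: multiplicity_times_same mult.assoc)

lemma val2_power_mult_odd: "odd q \<Longrightarrow> val2 (2 ^ k * q) = k"
  using val2_power_mult[of q k] val2_odd[of q] by (cases q) auto

lemma pos_decompose_2:
  fixes n :: nat
  assumes "0 < n"
  obtains k q where "n = 2 ^ k * q" "odd q"
  using multiplicity_decompose'[of n 2] assms
  by (metis gr_implies_not0 odd_one)

text \<open>The lowest binary digit 1 of \<open>i\<close> sits below position \<open>k\<close>,
  where adding a multiple of \<open>2 ^ k\<close> changes nothing. So a shift by such a multiple can
  only disturb letters at positions divisible by \<open>2 ^ k\<close>.\<close>

lemma val2_add_multiple: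
  assumes "0 < i" "val2 i < k"
  shows "val2 (i + 2 ^ k * q) = val2 i"
proof -
  obtain a b where i: "i = 2 ^ a * b" "odd b"
    using pos_decompose_2[OF assms(1)] .
  have a: "val2 i = a"
    unfolding i(1) using i(2) by (rule val2_power_mult_odd)
  obtain c where k: "k = Suc (a + c)"
    using assms(2) a less_imp_Suc_add by blast
  have "i + 2 ^ k * q = 2 ^ a * (b + 2 * (2 ^ c * q))"
    by (simp add: i k power_add algebra_simps)
  then show ?thesis
    using i(2) by (simp add: a val2_power_mult_odd)
qed

text \<open>For odd \<open>n\<close> the recursion halves the position \<open>Suc n\<close> and
  flips the letter, while halving removes one factor 2 and so flips the parity of the
  valuation.\<close>

lemma pd_letter_eq_1_iff: "pd_letter n = 1 \<longleftrightarrow> even (val2 (Suc n))"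
proof (induction n rule: less_induct)
  case (less n)
  show ?case
  proof (cases "even n")
    case True
    then show ?thesis by (simp add: pd_letter.simps[of n] val2_odd)
  next
    case False
    then have n: "Suc n = 2 * Suc (n div 2)" and "n div 2 < n"
      by (auto elim: oddE)
    have "val2 (Suc n) = Suc (val2 (Suc (n div 2)))"
      unfolding n by (rule multiplicity_times_same) auto
    then show ?thesis
      using False less[OF \<open>n div 2 < n\<close>] by (simp add: pd_letter.simps[of n])
  qed
qed

lemma pd_letter_eq_iff: "pd_letter m = pd_letter n \<longleftrightarrow> even (val2 (Suc m)) = even (val2 (Suc n))"
  using pd_letter_eq_1_iff[of m] pd_letter_eq_1_iff[of n]
  by (cases "pd_letter m"; cases "pd_letter n") auto

lemma stake_period_doubling_nth:
  assumes "i < n"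
  shows "stake n period_doubling ! i = pd_letter i"
proof -
  have "period_doubling = smap pd_letter nats"
    using period_doubling_fixed_point by (simp only: pd_fixed_point_iff)
  then have "period_doubling !! i = pd_letter i"
    by (rule ssubst) simp
  then show ?thesis using assms by simp
qed

section \<open>Characterisation of the periods of a prefix\<close>

lemma is_period_prefix_iff_val2:
  "is_period (stake n period_doubling) p \<longleftrightarrow>
     1 \<le> p \<and> p \<le> n \<and> (\<forall>i. 0 < i \<and> i + p \<le> n \<longrightarrow> even (val2 i) = even (val2 (i + p)))"
proof -
  have "(\<forall>i < n - p. stake n period_doubling ! i = stake n period_doubling ! (i + p)) \<longleftrightarrow>
      (\<forall>i < n - p. even (val2 (Suc i)) = even (val2 (Suc i + p)))"
    by (intro all_cong) (simp add: stake_period_doubling_nth pd_letter_eq_iff del: stake_nth)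
  also have "\<dots> \<longleftrightarrow> (\<forall>i. 0 < i \<and> i + p \<le> n \<longrightarrow> even (val2 i) = even (val2 (i + p)))"
    (is "?L \<longleftrightarrow> ?R")
  proof
    assume ?L
    show ?R
    proof (intro allI impI)
      fix i assume "0 < i \<and> i + p \<le> n"
      then have "i - 1 < n - p" "Suc (i - 1) = i" by linarith+
      then show "even (val2 i) = even (val2 (i + p))"
        using \<open>?L\<close>[rule_format, of "i - 1"] by simp
    qed
  next
    assume ?R
    show ?L
    proof (intro allI impI)
      fix i assume "i < n - p"
      then show "even (val2 (Suc i)) = even (val2 (Suc i + p))"
        using \<open>?R\<close>[rule_format, of "Suc i"] by simp
    qed
  qed
  finally show ?thesis by (simp add: is_period_def)
qed

lemma is_period_prefix_iff:
  assumes "odd q"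
  shows "is_period (stake n period_doubling) (2 ^ k * q) \<longleftrightarrow>
    2 ^ k * q \<le> n \<and> (n < 2 ^ k * (q + 1) \<or> n < 2 ^ k * (q + 2) \<and> even (val2 (q + 1)))"
    (is "?P \<longleftrightarrow> ?p \<le> n \<and> ?C")
proof -
  have q: "0 < q" using assms by (cases q) auto
  \<comment> \<open>Shifting the positions \<open>2 ^ k\<close> and \<open>2 ^ k * 2\<close> by
    \<open>?p\<close> gives \<open>2 ^ k * (q + 1)\<close> and \<open>2 ^ k * (q + 2)\<close>, where
    \<open>q + 2\<close> is odd. The second shift lowers the valuation from \<open>Suc k\<close> to
    \<open>k\<close>, a certain mismatch; the first adds \<open>val2 (q + 1)\<close>.\<close>
  have v1: "val2 (2 ^ k + ?p) = k + val2 (q + 1)"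
    using val2_power_mult[of "q + 1" k] by (simp add: algebra_simps)
  have v2: "val2 (2 ^ k * 2 + ?p) = k"
    using val2_power_mult_odd[of "q + 2" k] assms
    by (simp add: distrib_left add.commute del: add_2_eq_Suc')
  have u1: "val2 (2 ^ k) = k" and u2: "val2 (2 ^ k * 2) = Suc k"
    using val2_power_mult[of 1 k] val2_power_mult[of 1 "Suc k"] by (simp_all add: mult.commute)
  show ?thesis
  proof
    assume P: ?P
    then have per: "even (val2 i) = even (val2 (i + ?p))" if "0 < i" "i + ?p \<le> n" for i
      using that by (simp add: is_period_prefix_iff_val2)
    have "n < 2 ^ k * (q + 2)"
      using per[of "2 ^ k * 2"] v2 u2 by (force simp: algebra_simps)
    moreover have "even (val2 (q + 1))" if "\<not> n < 2 ^ k * (q + 1)"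
      using per[of "2 ^ k"] v1 u1 that by (auto simp: algebra_simps)
    ultimately show "?p \<le> n \<and> ?C"
      using P by (auto simp: is_period_prefix_iff_val2)
  next
    assume C: "?p \<le> n \<and> ?C"
    have "even (val2 i) = even (val2 (i + ?p))" if i: "0 < i" "i + ?p \<le> n" for i
    proof (cases "val2 i < k")
      case True
      then show ?thesis using i by (simp add: val2_add_multiple)
    next
      case False
      obtain a b where ab: "i = 2 ^ a * b" "odd b"
        using pos_decompose_2[OF i(1)] .
      then have "k \<le> a" using False by (simp add: val2_power_mult_odd)
      then obtain c where "a = k + c" using le_Suc_ex by blast
      then obtain j where j: "i = 2 ^ k * j"
        using ab by (simp add: power_add mult.assoc)
      \<comment> \<open>Only multiples of \<open>2 ^ k\<close> are left, and
        \<open>n < 2 ^ k * (q + 2)\<close> leaves room for \<open>j = 1\<close> alone. If that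
        position fits, the first alternative of \<open>?C\<close> fails, so
        \<open>val2 (q + 1)\<close> is even.\<close>
      have n: "2 ^ k * (j + q) \<le> n" using i j by (simp add: algebra_simps)
      have "0 < j" using i j by (cases j) auto
      have "n < 2 ^ k * (q + 2)" using C by (auto simp: algebra_simps)
      then have "2 ^ k * (j + q) < 2 ^ k * (q + 2)" using n by linarith
      then have "j < 2" by (simp only: mult_less_cancel1) simp
      then have j1: "j = 1" using \<open>0 < j\<close> by simp
      then have "even (val2 (q + 1))" using C n by (auto simp: algebra_simps)
      then show ?thesis using v1 u1 j j1 by simp
    qed
    then show ?P
      using C q by (auto simp: is_period_prefix_iff_val2)
  qed
qed

section \<open>Counting the nontrivial periods\<close>

definition prefix_periods :: "nat \<Rightarrow> nat set" where
  "prefix_periods n = {p. is_period (stake n period_doubling) p \<and> p < n}"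

lemma nnp_prefix: "nnp (stake n period_doubling) = card (prefix_periods n)"
  by (simp add: nnp_def prefix_periods_def)

lemma finite_prefix_periods [simp]: "finite (prefix_periods n)"
  by (rule finite_subset[of _ "{..<n}"]) (auto simp: prefix_periods_def)

lemma prefix_periods_decompose:
  assumes "p \<in> prefix_periods n"
  obtains k q where "val2 p = k" "odd q" "p = 2 ^ k * q" "2 ^ k * q < n"
    "n < 2 ^ k * (q + 1) \<or> n < 2 ^ k * (q + 2) \<and> even (val2 (q + 1))"
proof -
  have p: "is_period (stake n period_doubling) p" "p < n" "0 < p"
    using assms by (auto simp: prefix_periods_def is_period_def)
  obtain k q where kq: "p = 2 ^ k * q" "odd q"
    using pos_decompose_2[OF p(3)] .
  then have "val2 p = k" by (simp add: val2_power_mult_odd)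
  with that[of k q] kq p is_period_prefix_iff[of q n k] show thesis by auto
qed

text \<open>Both \<open>2 ^ k * q\<close> and \<open>2 ^ k * q'\<close> lie below \<open>n\<close>,
  and \<open>n\<close> lies below both \<open>2 ^ k * (q + 2)\<close> and
  \<open>2 ^ k * (q' + 2)\<close>. So \<open>q\<close> and \<open>q'\<close> differ by at most 1,
  and both are odd.\<close>

lemma inj_on_val2_prefix_periods: "inj_on val2 (prefix_periods n)"
proof (rule inj_onI)
  fix p p' assume p: "p \<in> prefix_periods n" "p' \<in> prefix_periods n" "val2 p = val2 p'"
  obtain k q where q: "val2 p = k" "odd q" "p = 2 ^ k * q" "2 ^ k * q < n"
      "n < 2 ^ k * (q + 1) \<or> n < 2 ^ k * (q + 2) \<and> even (val2 (q + 1))"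
    by (rule prefix_periods_decompose[OF p(1)])
  obtain k' q' where q': "val2 p' = k'" "odd q'" "p' = 2 ^ k' * q'" "2 ^ k' * q' < n"
      "n < 2 ^ k' * (q' + 1) \<or> n < 2 ^ k' * (q' + 2) \<and> even (val2 (q' + 1))"
    by (rule prefix_periods_decompose[OF p(2)])
  have k': "k' = k" using p(3) q(1) q'(1) by simp
  have "n < 2 ^ k * (q + 2)" "n < 2 ^ k * (q' + 2)"
    using q(5) q'(5) unfolding k' by (auto simp: algebra_simps)
  then have "2 ^ k * q' < 2 ^ k * (q + 2)" "2 ^ k * q < 2 ^ k * (q' + 2)"
    using q(4) q'(4) unfolding k' by linarith+
  then have "q' < q + 2" "q < q' + 2" by (simp_all only: mult_less_cancel1)
  with q(2) q'(2) have "q = q'" by presburger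
  then show "p = p'" using q(3) q'(3) k' by simp
qed

text \<open>By injectivity it suffices to count valuations, and a period of valuation
  \<open>k\<close> is at least \<open>2 ^ k\<close>.\<close>

lemma nnp_prefix_le:
  assumes "n < 2 ^ m"
  shows "nnp (stake n period_doubling) \<le> m"
proof -
  have "val2 ` prefix_periods n \<subseteq> {..<m}"
  proof
    fix k assume "k \<in> val2 ` prefix_periods n"
    then obtain p where p: "p \<in> prefix_periods n" "k = val2 p" by auto
    obtain q where q: "odd q" "2 ^ k * q < n"
      using prefix_periods_decompose[OF p(1), folded p(2)] by metis
    have "2 ^ k * 1 \<le> 2 ^ k * q" using q(1) by (intro mult_le_mono2) (cases q, auto)
    then have "(2::nat) ^ k < 2 ^ m" using q(2) assms by linarith
    then show "k \<in> {..<m}" by simp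
  qed
  then have "card (val2 ` prefix_periods n) \<le> card {..<m}" by (intro card_mono) auto
  then show ?thesis
    by (simp add: nnp_prefix card_image inj_on_val2_prefix_periods)
qed

text \<open>From \<open>2 ^ k * q < 2 ^ m\<close> it follows that \<open>2 ^ (m - k)\<close> is at
  least \<open>q + 1\<close>, so only the second alternative can hold, with
  \<open>q + 1 = 2 ^ (m - k)\<close>. The valuation \<open>m - k\<close> of this number must be
  even, so every second valuation is lost.\<close>

lemma nnp_prefix_power_le: "nnp (stake (2 ^ m) period_doubling) \<le> m div 2"
proof -
  have "val2 ` prefix_periods (2 ^ m) \<subseteq> (\<lambda>j. m - 2 * j) ` {1..m div 2}"
  proof
    fix k assume "k \<in> val2 ` prefix_periods (2 ^ m)"
    then obtain p where p: "p \<in> prefix_periods (2 ^ m)" "k = val2 p" by auto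
    obtain q where q: "odd q" "2 ^ k * q < 2 ^ m"
        "2 ^ m < 2 ^ k * (q + 1) \<or> 2 ^ m < 2 ^ k * (q + 2) \<and> even (val2 (q + 1))"
      using prefix_periods_decompose[OF p(1), folded p(2)] by metis
    have "2 ^ k * 1 \<le> 2 ^ k * q" using q(1) by (intro mult_le_mono2) (cases q, auto)
    then have "(2::nat) ^ k < 2 ^ m" using q(2) by linarith
    then have km: "k < m" by simp
    then have m: "(2::nat) ^ m = 2 ^ k * 2 ^ (m - k)" by (simp flip: power_add)
    have "q < 2 ^ (m - k)" using q(2) unfolding m by simp
    moreover have "2 ^ (m - k) < q + 1 \<or> 2 ^ (m - k) < q + 2 \<and> even (val2 (q + 1))"
      using q(3) unfolding m by (simp only: mult_less_cancel1) auto
    ultimately have "q + 1 = 2 ^ (m - k)" "even (val2 (q + 1))" by auto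
    then have "even (m - k)" using val2_power_mult[of 1 "m - k"] by simp
    then have "k = m - 2 * ((m - k) div 2)" "(m - k) div 2 \<in> {1..m div 2}"
      using km by (auto elim!: evenE) (use \<open>even (m - k)\<close> km in presburger)
    then show "k \<in> (\<lambda>j. m - 2 * j) ` {1..m div 2}" by blast
  qed
  then have "card (val2 ` prefix_periods (2 ^ m)) \<le> card ((\<lambda>j. m - 2 * j) ` {1..m div 2})"
    by (intro card_mono) auto
  also have "\<dots> \<le> card {1..m div 2}" by (rule card_image_le) simp
  finally show ?thesis
    by (simp add: nnp_prefix card_image inj_on_val2_prefix_periods)
qed

text \<open>An odd quotient of \<open>n\<close> by \<open>2 ^ Suc k\<close> or \<open>2 ^ k\<close>
  (\<open>f\<close> or \<open>g\<close> below) is itself a suitable \<open>q\<close>. If both are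
  even, then \<open>g = 2 * f\<close>, so exactly one of \<open>val2 f\<close> and
  \<open>val2 g\<close> is even, and the predecessor of that quotient is an odd \<open>q\<close>
  meeting the second alternative of \<open>is_period_prefix_iff\<close>.\<close>

lemma ex_period_val2_adjacent:
  assumes "2 ^ Suc k \<le> n"
  shows "\<exists>p. is_period (stake n period_doubling) p \<and> (val2 p = k \<or> val2 p = Suc k)"
proof -
  define f where "f = n div 2 ^ Suc k"
  define g where "g = n div 2 ^ k"
  have f: "2 ^ Suc k * f \<le> n" "n < 2 ^ Suc k * (f + 1)"
    unfolding f_def using dividend_less_times_div[of "2 ^ Suc k" n] by simp_all
  have g: "2 ^ k * g \<le> n" "n < 2 ^ k * (g + 1)"
    unfolding g_def using dividend_less_times_div[of "2 ^ k" n] by simp_all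
  have "f = g div 2"
    unfolding f_def g_def by (simp only: power_Suc2 div_mult2_eq)
  have "0 < f" using assms by (simp add: f_def div_greater_zero_iff)
  have *: ?thesis if q: "odd q" "j = k \<or> j = Suc k" "2 ^ j * q \<le> n"
      "n < 2 ^ j * (q + 1) \<or> n < 2 ^ j * (q + 2) \<and> even (val2 (q + 1))" for q j
    using q is_period_prefix_iff[of q n j]
    by (intro exI[of _ "2 ^ j * q"]) (auto simp: val2_power_mult_odd)
  consider "odd f" | "odd g" | "even f" "even (val2 f)" | "even g" "odd (val2 f)" by blast
  then show ?thesis
  proof cases
    case 1
    then show ?thesis using f by (intro *[of f "Suc k"]) auto
  next
    case 2
    then show ?thesis using g by (intro *[of g k]) auto
  next
    case 3
    then obtain h where "f = Suc h" using \<open>0 < f\<close> by (cases f) auto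
    then show ?thesis using 3 f by (intro *[of h "Suc k"]) (auto simp: algebra_simps)
  next
    case 4
    then have g2: "g = 2 * f" using \<open>f = g div 2\<close> by auto
    then have "even (val2 g)" using 4 \<open>0 < f\<close> by (simp add: multiplicity_times_same)
    have "0 < g" using \<open>0 < f\<close> g2 by simp
    then obtain h where "g = Suc h" by (cases g) auto
    then show ?thesis using 4 g \<open>even (val2 g)\<close> by (intro *[of h k]) (auto simp: algebra_simps)
  qed
qed

text \<open>Each pair of valuations \<open>2 * j\<close>, \<open>Suc (2 * j)\<close> with
  \<open>j < m div 2\<close> supplies a period, and different pairs supply different ones.\<close>

lemma nnp_prefix_ge:
  assumes "2 ^ m \<le> n"
  shows "m div 2 \<le> Suc (nnp (stake n period_doubling))"
proof -
  \<comment> \<open>One of these periods may be the trivial one, so \<open>n\<close> is inserted;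
    this costs the \<open>Suc\<close> in the conclusion.\<close>
  have "{..<m div 2} \<subseteq> (\<lambda>p. val2 p div 2) ` insert n (prefix_periods n)"
  proof
    fix j assume "j \<in> {..<m div 2}"
    then have "Suc (2 * j) \<le> m" by auto
    then have "(2::nat) ^ Suc (2 * j) \<le> 2 ^ m" by (intro power_increasing) auto
    then obtain p where p: "is_period (stake n period_doubling) p"
        "val2 p = 2 * j \<or> val2 p = Suc (2 * j)"
      using ex_period_val2_adjacent[of "2 * j" n] assms by auto
    then have "p \<in> insert n (prefix_periods n)" by (auto simp: prefix_periods_def is_period_def)
    moreover have "j = val2 p div 2" using p(2) by auto
    ultimately show "j \<in> (\<lambda>p. val2 p div 2) ` insert n (prefix_periods n)" by blast
  qed
  then have "card {..<m div 2} \<le> card (insert n (prefix_periods n))"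
    by (intro surj_card_le) auto
  also have "\<dots> \<le> Suc (card (prefix_periods n))" by (rule card_insert_le_m1) auto
  finally show ?thesis by (simp add: nnp_prefix)
qed

text \<open>The witness \<open>2 ^ m - 2 ^ k\<close> has odd part
  \<open>q = 2 ^ (m - k) - 1\<close>, so \<open>2 ^ k * (q + 1)\<close> is \<open>2 ^ m\<close>,
  just above the length. The choice \<open>k = 0\<close> gives the trivial period, which leaves
  \<open>m - 1\<close> of them.\<close>

lemma nnp_prefix_power_minus_1_ge: "m - 1 \<le> nnp (stake (2 ^ m - 1) period_doubling)"
proof -
  have "(\<lambda>k. 2 ^ m - 2 ^ k) ` {1..<m} \<subseteq> prefix_periods (2 ^ m - 1)"
  proof
    fix p assume "p \<in> (\<lambda>k. 2 ^ m - 2 ^ k :: nat) ` {1..<m}"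
    then obtain k where k: "1 \<le> k" "k < m" "p = 2 ^ m - 2 ^ k" by auto
    then have m: "(2::nat) ^ m = 2 ^ k * 2 ^ (m - k)" by (simp flip: power_add)
    have p: "p = 2 ^ k * (2 ^ (m - k) - 1)" by (simp add: k(3) m algebra_simps)
    have "1 < (2::nat) ^ k" using k by (intro one_less_power) auto
    moreover have "(2::nat) ^ k < 2 ^ m" using k by simp
    ultimately have less: "p < 2 ^ m - 1" unfolding k(3) by linarith
    have "is_period (stake (2 ^ m - 1) period_doubling) p"
      unfolding p using less k by (subst is_period_prefix_iff) (auto simp: p m)
    then show "p \<in> prefix_periods (2 ^ m - 1)" using less by (simp add: prefix_periods_def)
  qed
  then have "card ((\<lambda>k. 2 ^ m - 2 ^ k :: nat) ` {1..<m}) \<le> card (prefix_periods (2 ^ m - 1))"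
    by (intro card_mono) auto
  moreover have "inj_on (\<lambda>k. 2 ^ m - 2 ^ k :: nat) {1..<m}"
  proof (rule inj_onI)
    fix j k assume jk: "j \<in> {1..<m}" "k \<in> {1..<m}" "2 ^ m - 2 ^ j = (2 ^ m - 2 ^ k :: nat)"
    have "(2::nat) ^ j < 2 ^ m" "(2::nat) ^ k < 2 ^ m" using jk by simp_all
    then have "(2::nat) ^ j = 2 ^ k" using jk(3) by linarith
    then show "j = k" by simp
  qed
  ultimately show ?thesis by (simp add: nnp_prefix card_image)
qed

section \<open>The initial critical exponent\<close>

lemma prefix_length_le_twice_period:
  assumes "is_period (stake n period_doubling) p"
  shows "n \<le> 2 * p"
proof -
  have "0 < p" using assms by (simp add: is_period_def)
  then obtain k q where kq: "p = 2 ^ k * q" "odd q"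
    by (rule pos_decompose_2)
  then have C: "n < 2 ^ k * (q + 1) \<or> n < 2 ^ k * (q + 2) \<and> even (val2 (q + 1))"
    using assms by (simp add: is_period_prefix_iff)
  \<comment> \<open>For \<open>q = 1\<close> the valuation of \<open>q + 1\<close> is odd, so only
    the alternative \<open>n < 2 ^ k * 2\<close> remains. Any other odd \<open>q\<close> is at least
    3, and then the weaker alternative suffices.\<close>
  have val2_2: "val2 2 = 1" using val2_power_mult_odd[of 1 1] by simp
  show ?thesis
  proof (cases "q = 1")
    case True
    then show ?thesis using C val2_2 by (auto simp: kq numeral_2_eq_2)
  next
    case False
    then have "q + 2 \<le> 2 * q" using kq(2) by (cases q) auto
    then have "2 ^ k * (q + 2) \<le> 2 ^ k * (2 * q)" by (rule mult_le_mono2)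
    moreover have "n \<le> 2 ^ k * (q + 2)" using C by (auto simp: algebra_simps)
    ultimately show ?thesis unfolding kq(1) by linarith
  qed
qed

lemma is_period_per:
  assumes "w \<noteq> []"
  shows "is_period w (per w)"
  unfolding per_def
  by (rule LeastI[of _ "length w"]) (use assms in \<open>auto simp: is_period_def Suc_le_eq\<close>)

lemma word_exp_prefix_le_2:
  assumes "0 < n"
  shows "word_exp (stake n period_doubling) \<le> 2"
proof -
  let ?w = "stake n period_doubling"
  have "is_period ?w (per ?w)" using assms by (intro is_period_per) (cases n, auto)
  then have "n \<le> 2 * per ?w" "0 < per ?w"
    using prefix_length_le_twice_period by (auto simp: is_period_def)
  then have "real n \<le> 2 * real (per ?w)" by linarith
  then show ?thesis using \<open>0 < per ?w\<close> by (simp add: word_exp_def field_simps)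
qed

lemma prefix_stake_iff: "prefix u (stake n s) \<longleftrightarrow> (\<exists>j\<le>n. u = stake j s)"
proof
  assume "prefix u (stake n s)"
  then have "u = take (length u) (stake n s)" "length u \<le> n"
    by (metis prefix_def append_eq_conv_conj)
      (metis \<open>prefix u (stake n s)\<close> prefix_length_le length_stake)
  then show "\<exists>j\<le>n. u = stake j s" by (metis min.absorb1 take_stake)
next
  assume "\<exists>j\<le>n. u = stake j s"
  then show "prefix u (stake n s)" by (metis min.absorb1 take_is_prefix take_stake)
qed

lemma ice_prefix_le_2:
  assumes "0 < n"
  shows "ice (stake n period_doubling) \<le> 2"
  unfolding ice_def
proof (rule cSup_least)
  show "{word_exp u |u. u \<noteq> [] \<and> prefix u (stake n period_doubling)} \<noteq> {}"
    using assms by (auto intro!: exI[of _ "stake n period_doubling"] simp: gr0_conv_Suc)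
next
  fix x assume "x \<in> {word_exp u |u. u \<noteq> [] \<and> prefix u (stake n period_doubling)}"
  then obtain j where "x = word_exp (stake j period_doubling)" "0 < j"
    by (auto simp: prefix_stake_iff)
  then show "x \<le> 2" by (simp add: word_exp_prefix_le_2)
qed

lemma word_exp_le_ice_prefix:
  assumes "0 < j" "j \<le> n"
  shows "word_exp (stake j period_doubling) \<le> ice (stake n period_doubling)"
  unfolding ice_def
proof (rule cSup_upper)
  show "word_exp (stake j period_doubling)
      \<in> {word_exp u |u. u \<noteq> [] \<and> prefix u (stake n period_doubling)}"
    using assms by (auto simp: prefix_stake_iff gr0_conv_Suc)
  show "bdd_above {word_exp u |u. u \<noteq> [] \<and> prefix u (stake n period_doubling)}"
  proof (rule bdd_aboveI)
    fix x assume "x \<in> {word_exp u |u. u \<noteq> [] \<and> prefix u (stake n period_doubling)}"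
    then obtain j where "x = word_exp (stake j period_doubling)" "0 < j"
      by (auto simp: prefix_stake_iff)
    then show "x \<le> 2" by (simp add: word_exp_prefix_le_2)
  qed
qed

text \<open>By \<open>is_period_prefix_iff\<close> with \<open>q = 1\<close>, the period
  \<open>2 ^ m\<close> breaks at length \<open>2 * 2 ^ m\<close>, so this is the longest prefix that
  has it.\<close>

lemma word_exp_prefix_power_minus_1_ge:
  "2 - 1 / 2 ^ m \<le> word_exp (stake (2 ^ Suc m - 1) period_doubling)"
proof -
  let ?w = "stake (2 ^ Suc m - 1) period_doubling"
  have "(2::nat) ^ m \<le> 2 ^ Suc m - 1" by (simp add: mult_2 Suc_le_eq)
  then have "is_period ?w (2 ^ m)"
    using is_period_prefix_iff[of 1 "2 ^ Suc m - 1" m] by (simp add: mult_2)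
  then have per: "per ?w \<le> 2 ^ m" unfolding per_def by (rule Least_le)
  have "?w \<noteq> []" using \<open>(2::nat) ^ m \<le> 2 ^ Suc m - 1\<close> 
    by (metis length_stake list.size(3) le_zero_eq power_not_zero zero_neq_numeral)
  then have pos: "0 < per ?w" using is_period_per[of ?w] by (simp add: is_period_def)
  have "2 - 1 / 2 ^ m = (2 ^ Suc m - 1) / real (2 ^ m)" by (simp add: field_simps)
  also have "\<dots> \<le> (2 ^ Suc m - 1) / real (per ?w)"
  proof (rule divide_left_mono)
    show "real (per ?w) \<le> real (2 ^ m)" using per by (simp only: of_nat_le_iff)
    show "0 \<le> (2 ^ Suc m - 1 :: real)" using one_le_power[of "2::real" "Suc m"] by simp
    show "0 < real (2 ^ m) * real (per ?w)" using pos by simp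
  qed
  also have "\<dots> = word_exp ?w" by (simp add: word_exp_def of_nat_diff)
  finally show ?thesis .
qed

lemma ice_prefix_ge:
  assumes "0 < n"
  shows "2 - 4 / (real n + 1) \<le> ice (stake n period_doubling)"
proof -
  \<comment> \<open>Powers of 2 around \<open>n + 1\<close> rather than \<open>n\<close> make the
    prefix of length \<open>2 ^ l - 1\<close> fit. The 4 in the bound comes from
    \<open>n + 1 < 2 ^ (l + 1)\<close>, which is \<open>4 * 2 ^ m\<close>.\<close>
  obtain l where l: "2 ^ l \<le> n + 1" "n + 1 < 2 ^ (l + 1)"
    using ex_power_ivl1[of 2 "n + 1"] by auto
  have "l \<noteq> 0" using l assms by (intro notI) simp
  then obtain m where m: "l = Suc m" by (cases l) auto
  have "real (n + 1) < real (2 ^ (l + 1))" using l(2) by (simp only: of_nat_less_iff)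
  then have "1 / 2 ^ m \<le> 4 / (real n + 1)" by (simp add: m field_simps)
  then have "2 - 4 / (real n + 1) \<le> 2 - 1 / 2 ^ m" by simp
  also have "\<dots> \<le> word_exp (stake (2 ^ Suc m - 1) period_doubling)"
    by (rule word_exp_prefix_power_minus_1_ge)
  also have "\<dots> \<le> ice (stake n period_doubling)"
    using l(1) m one_less_power[of "2::nat" "Suc m"] by (intro word_exp_le_ice_prefix) auto
  finally show ?thesis .
qed

section \<open>The limit superior and the limit inferior\<close>

lemma nnp_prefix_le_log:
  assumes "0 < n"
  shows "real (nnp (stake n period_doubling)) \<le> log 2 (real n) + 1"
proof -
  obtain m where m: "2 ^ m \<le> n" "n < 2 ^ (m + 1)"
    using ex_power_ivl1[of 2 n] assms by auto
  have "real (2 ^ m) \<le> real n" using m(1) by (simp only: of_nat_le_iff)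
  then have "real m \<le> log 2 (real n)" by (intro le_log_of_power) auto
  then show ?thesis using nnp_prefix_le[OF m(2)] by linarith
qed

text \<open>The loss of 2 is made up of 1/2 for rounding in \<open>m div 2\<close>, 1 for the
  trivial period, and 1/2 for replacing \<open>m\<close> by \<open>log 2 n - 1\<close>.\<close>

lemma nnp_prefix_ge_log:
  assumes "0 < n"
  shows "log 2 (real n) / 2 - 2 \<le> real (nnp (stake n period_doubling))"
proof -
  obtain m where m: "2 ^ m \<le> n" "n < 2 ^ (m + 1)"
    using ex_power_ivl1[of 2 n] assms by auto
  have "real n < real (2 ^ (m + 1))" using m(2) by (simp only: of_nat_less_iff)
  then have "log 2 (real n) < real (m + 1)" using assms by (intro log_of_power_less) auto
  then show ?thesis using nnp_prefix_ge[OF m(1)] by linarith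
qed

text \<open>Squeezing \<open>ice\<close> towards 2 reduces both limits to the count of periods. At
  \<open>n = 1\<close> both factors of the second denominator vanish, hence
  \<open>1 < n\<close>.\<close>

lemma M_prefix_bounds:
  assumes "1 < n"
  shows "real (nnp (stake n period_doubling)) / (2 * ln (real n)) \<le> M (stake n period_doubling)"
    and "M (stake n period_doubling) \<le>
      real (nnp (stake n period_doubling)) / ((2 - 4 / (real n + 1)) * ln (real n))"
proof -
  have ln: "0 < ln (real n)" using assms by simp
  have lower: "0 < 2 - 4 / (real n + 1)" using assms by (simp add: field_simps)
  have ice: "2 - 4 / (real n + 1) \<le> ice (stake n period_doubling)"
      "ice (stake n period_doubling) \<le> 2"
    using assms by (simp_all add: ice_prefix_ge ice_prefix_le_2)
  show "real (nnp (stake n period_doubling)) / (2 * ln (real n)) \<le> M (stake n period_doubling)"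
    unfolding M_def length_stake using ln lower ice
    by (intro frac_le mult_right_mono mult_pos_pos) auto
  show "M (stake n period_doubling) \<le>
      real (nnp (stake n period_doubling)) / ((2 - 4 / (real n + 1)) * ln (real n))"
    unfolding M_def length_stake using ln lower ice
    by (intro frac_le mult_right_mono mult_pos_pos) auto
qed

lemma P_upper_period_doubling: "P_upper period_doubling = ereal (1 / (2 * ln 2))"
proof (rule antisym)
  let ?M = "\<lambda>n. ereal (M (stake n period_doubling))"
  let ?U = "\<lambda>n. (log 2 (real n) + 1) / ((2 - 4 / (real n + 1)) * ln (real n))"
  have "\<forall>\<^sub>F n in sequentially. ?M n \<le> ereal (?U n)"
    using eventually_gt_at_top[of 1]
  proof eventually_elim
    case (elim n)
    have "0 < 2 - 4 / (real n + 1)" "0 < ln (real n)" using elim by (simp_all add: field_simps)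
    then have "real (nnp (stake n period_doubling)) / ((2 - 4 / (real n + 1)) * ln (real n)) \<le> ?U n"
      using nnp_prefix_le_log[of n] elim by (intro divide_right_mono) auto
    then show ?case using M_prefix_bounds(2)[OF elim] by simp
  qed
  then have "limsup ?M \<le> limsup (\<lambda>n. ereal (?U n))" by (rule Limsup_mono)
  also have "?U \<longlonglongrightarrow> 1 / (2 * ln 2)" unfolding log_def by (real_asymp simp: field_simps)
  then have "limsup (\<lambda>n. ereal (?U n)) = ereal (1 / (2 * ln 2))"
    by (intro lim_imp_Limsup) auto
  finally show "P_upper period_doubling \<le> ereal (1 / (2 * ln 2))" by (simp add: P_upper_def)

  \<comment> \<open>A subsequence bounds the limit superior from below. These lengths nearly attain
    \<open>nnp_prefix_le\<close>, and the exponent \<open>Suc m\<close> makes the count at least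
    \<open>m\<close>.\<close>
  define r where "r m = 2 ^ Suc m - (1::nat)" for m
  let ?L = "\<lambda>m. real m / (2 * (real (Suc m) * ln 2))"
  have "strict_mono r"
    unfolding r_def by (intro strict_monoI diff_less_mono power_strict_increasing) auto
  have "?L \<longlonglongrightarrow> 1 / (2 * ln 2)" by (real_asymp simp: field_simps)
  then have "ereal (1 / (2 * ln 2)) = limsup (\<lambda>m. ereal (?L m))"
    by (intro lim_imp_Limsup[symmetric]) auto
  also have "\<dots> \<le> limsup (?M \<circ> r)"
  proof (rule Limsup_mono)
    show "\<forall>\<^sub>F m in sequentially. ereal (?L m) \<le> (?M \<circ> r) m"
      using eventually_gt_at_top[of 0]
    proof eventually_elim
      case (elim m)
      have "(2::nat) ^ 2 \<le> 2 ^ Suc m" using elim by (intro power_increasing) auto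
      then have r: "1 < r m" by (simp add: r_def)
      have nnp: "m \<le> nnp (stake (r m) period_doubling)"
        using nnp_prefix_power_minus_1_ge[of "Suc m"] by (simp add: r_def)
      have "real (r m) \<le> 2 ^ Suc m" by (simp add: r_def of_nat_diff)
      then have "ln (real (r m)) \<le> ln (2 ^ Suc m)" using r by (subst ln_le_cancel_iff) auto
      then have "ln (real (r m)) \<le> real (Suc m) * ln 2" by (simp only: ln_realpow zero_less_numeral)
      then have "?L m \<le> real (nnp (stake (r m) period_doubling)) / (2 * ln (real (r m)))"
        using nnp r by (intro frac_le mult_left_mono) auto
      also have "\<dots> \<le> M (stake (r m) period_doubling)" by (rule M_prefix_bounds(1)[OF r])
      finally show ?case by simp
    qed
  qed
  also have "\<dots> \<le> limsup ?M" using \<open>strict_mono r\<close> by (rule limsup_subseq_mono)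
  finally show "ereal (1 / (2 * ln 2)) \<le> P_upper period_doubling" by (simp add: P_upper_def)
qed

lemma p_lower_period_doubling: "p_lower period_doubling = ereal (1 / (4 * ln 2))"
proof (rule antisym)
  let ?M = "\<lambda>n. ereal (M (stake n period_doubling))"
  let ?L = "\<lambda>n. (log 2 (real n) / 2 - 2) / (2 * ln (real n))"
  have "?L \<longlonglongrightarrow> 1 / (4 * ln 2)" unfolding log_def by (real_asymp simp: field_simps)
  then have "ereal (1 / (4 * ln 2)) = liminf (\<lambda>n. ereal (?L n))"
    by (intro lim_imp_Liminf[symmetric]) auto
  also have "\<dots> \<le> liminf ?M"
  proof (rule Liminf_mono)
    show "\<forall>\<^sub>F n in sequentially. ereal (?L n) \<le> ?M n"
      using eventually_gt_at_top[of 1]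
    proof eventually_elim
      case (elim n)
      have "?L n \<le> real (nnp (stake n period_doubling)) / (2 * ln (real n))"
        using nnp_prefix_ge_log[of n] elim by (intro divide_right_mono) auto
      then show ?case using M_prefix_bounds(1)[OF elim] by simp
    qed
  qed
  finally show "ereal (1 / (4 * ln 2)) \<le> p_lower period_doubling" by (simp add: p_lower_def)

  \<comment> \<open>A subsequence bounds the limit inferior from above; at powers of 2 at most every
    second valuation carries a period.\<close>
  define r where "r m = (2::nat) ^ m" for m
  let ?U = "\<lambda>m. (real m / 2) / ((2 - 4 / (2 ^ m + 1)) * (real m * ln 2))"
  have "strict_mono r" unfolding r_def by (intro strict_monoI power_strict_increasing) auto
  then have "liminf ?M \<le> liminf (?M \<circ> r)" by (rule liminf_subseq_mono)
  also have "\<dots> \<le> liminf (\<lambda>m. ereal (?U m))"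
  proof (rule Liminf_mono)
    show "\<forall>\<^sub>F m in sequentially. (?M \<circ> r) m \<le> ereal (?U m)"
      using eventually_gt_at_top[of 0]
    proof eventually_elim
      case (elim m)
      have r: "1 < r m" unfolding r_def using elim by (intro one_less_power) auto
      have pos: "0 < 2 - 4 / (real (r m) + 1)" using r by (simp add: field_simps)
      have ln: "ln (real (r m)) = real m * ln 2" by (simp add: r_def ln_realpow)
      have "M (stake (r m) period_doubling) \<le>
          real (nnp (stake (r m) period_doubling)) / ((2 - 4 / (real (r m) + 1)) * ln (real (r m)))"
        by (rule M_prefix_bounds(2)[OF r])
      also have "\<dots> \<le> (real m / 2) / ((2 - 4 / (real (r m) + 1)) * ln (real (r m)))"
      proof (rule divide_right_mono)
        show "real (nnp (stake (r m) period_doubling)) \<le> real m / 2"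
          using nnp_prefix_power_le[of m] unfolding r_def by linarith
        show "0 \<le> (2 - 4 / (real (r m) + 1)) * ln (real (r m))"
          using pos r by (intro mult_nonneg_nonneg) auto
      qed
      also have "\<dots> = ?U m" unfolding ln by (simp add: r_def)
      finally show ?case by simp
    qed
  qed
  also have "?U \<longlonglongrightarrow> 1 / (4 * ln 2)" by (real_asymp simp: field_simps)
  then have "liminf (\<lambda>m. ereal (?U m)) = ereal (1 / (4 * ln 2))"
    by (intro lim_imp_Liminf) auto
  finally show "p_lower period_doubling \<le> ereal (1 / (4 * ln 2))" by (simp add: p_lower_def)
qed

section \<open>Numerical values\<close>

lemma ln_2_bounds: "0.693145 < ln (2::real)" "ln (2::real) < 0.69315"
  \<comment> \<open>Both numerical estimates of the theorem require
    \<open>1.4427 * ln 2 > 1\<close>, that is, \<open>ln 2\<close> above about 0.6931448, so the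
    lower bound has little slack.\<close>
  using ln_approx_bounds[of 2 5]
  by (simp_all add: lessThan_nat_numeral lessThan_Suc power_divide)

theorem theorem14:
  shows "P_upper period_doubling = ereal (1 / (2 * ln 2))
       \<and> \<bar>1 / (2 * ln 2) - (0.7213 :: real)\<bar> < 0.00005
       \<and> p_lower period_doubling = ereal (1 / (4 * ln 2))
       \<and> \<bar>1 / (4 * ln 2) - (0.36067 :: real)\<bar> < 0.000005"
proof (intro conjI P_upper_period_doubling p_lower_period_doubling)
  have pos: "0 < ln (2::real)" by simp
  show "\<bar>1 / (2 * ln 2) - (0.7213 :: real)\<bar> < 0.00005"
    using ln_2_bounds pos unfolding abs_less_iff by (simp add: field_simps)
  show "\<bar>1 / (4 * ln 2) - (0.36067 :: real)\<bar> < 0.000005"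
    using ln_2_bounds pos unfolding abs_less_iff by (simp add: field_simps)
qed

end
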